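(* Let $\theta_1,\theta_2>0$ with $\theta_1<2\theta_2$ and $\theta_2<2\theta_1$, and let $H:\mathbb{R}_+^2\to\mathbb{R}_+^2$ be $$H(x_1,x_2)=\Big(\tfrac{\theta_1x_1}{2}(x_1+2x_2),\ \tfrac{\theta_2x_2}{2}(x_2+2x_1)\Big).$$ The unstable curve of the saddle fixed point $\overline{E}=\big(\tfrac{4\theta_1-2\theta_2}{3\theta_1\theta_2},\tfrac{4\theta_2-2\theta_1}{3\theta_1\theta_2}\big)$ is the line $$x_2=\frac{2\theta_2-\theta_1}{2\theta_1-\theta_2}\,x_1,$$ which passes through the origin and $\overline{E}$.
   Context: $\mathbb{R}_+^2=\{(x_1,x_2): x_1\ge0,\ x_2\ge0\}$. A saddle is a fixed point at which the Jacobian matrix of $H$ has one eigenvalue of absolute value less than $1$ and one of absolute value greater than $1$. "Unstable curve" is used in its usual sense for discrete-time dynamical systems: the invariant curve through $\overline{E}$ along which trajectories move away from $\overline{E}$. *)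

theory Defs
  imports "HOL-Analysis.Analysis"
begin

definition quadrant :: "(real^2) set" where
  "quadrant = {x. 0 \<le> x $ 1 \<and> 0 \<le> x $ 2}"

text \<open>Complex eigenvalues of a real matrix, so that no eigenvalue is excluded by the
  definition of a saddle.\<close>

definition is_eigenvalue :: "real^2^2 \<Rightarrow> complex \<Rightarrow> bool" where
  "is_eigenvalue A l \<longleftrightarrow>
     (\<exists>v :: complex^2. v \<noteq> 0 \<and> (\<chi> i j. complex_of_real (A $ i $ j)) *v v = l *s v)"

text \<open>Differentiability is required explicitly because \<^const>\<open>jacobian\<close> is
  unspecified without it.\<close>

definition saddle :: "(real^2 \<Rightarrow> real^2) \<Rightarrow> real^2 \<Rightarrow> bool" where
  "saddle F p \<longleftrightarrow> F p = p \<and> F differentiable (at p) \<and>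
     (\<exists>l m. is_eigenvalue (jacobian F (at p)) l \<and> is_eigenvalue (jacobian F (at p)) m \<and>
            cmod l < 1 \<and> 1 < cmod m)"

text \<open>The global unstable set of a fixed point \<open>p\<close> of a map \<open>F\<close> on \<open>D\<close>: the points with a
  backward orbit in \<open>D\<close> tending to \<open>p\<close>. The backward orbit is existentially quantified
  because \<open>F\<close> need not be injective.\<close>

definition unstable_set :: "'a::topological_space set \<Rightarrow> ('a \<Rightarrow> 'a) \<Rightarrow> 'a \<Rightarrow> 'a set" where
  "unstable_set D F p =
     {x. \<exists>y :: nat \<Rightarrow> 'a. y 0 = x \<and> (\<forall>n. y n \<in> D \<and> F (y (Suc n)) = y n) \<and> y \<longlonglongrightarrow> p}"

definition H :: "real \<Rightarrow> real \<Rightarrow> real^2 \<Rightarrow> real^2" where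
  "H \<theta>1 \<theta>2 x = vector [\<theta>1 * x $ 1 / 2 * (x $ 1 + 2 * x $ 2),
                       \<theta>2 * x $ 2 / 2 * (x $ 2 + 2 * x $ 1)]"

definition Ebar :: "real \<Rightarrow> real \<Rightarrow> real^2" where
  "Ebar \<theta>1 \<theta>2 = vector [(4 * \<theta>1 - 2 * \<theta>2) / (3 * \<theta>1 * \<theta>2),
                       (4 * \<theta>2 - 2 * \<theta>1) / (3 * \<theta>1 * \<theta>2)]"

text \<open>The line is taken inside the domain of the map.\<close>

definition unstable_line :: "real \<Rightarrow> real \<Rightarrow> (real^2) set" where
  "unstable_line \<theta>1 \<theta>2 =
     {x \<in> quadrant. x $ 2 = (2 * \<theta>2 - \<theta>1) / (2 * \<theta>1 - \<theta>2) * x $ 1}"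

end

theory Submission
  imports Defs
begin

text \<open>The map is homogeneous of degree two, so on the ray through \<open>Ebar\<close> it acts by
  \<open>t \<mapsto> t\<^sup>2\<close>, whose iterated square roots \<open>t powr (1/2^n)\<close> give the backward orbits. Transversally,
  \<open>(b x1 - a x2) / x2\<close> with \<open>(a, b) = Ebar\<close> does not grow in absolute value along forward
  orbits in the open quadrant, so it vanishes on every backward orbit along which it tends to
  \<open>0\<close>.\<close>

section \<open>The map and its Jacobian matrix\<close>

lemma H_nth [simp]:
  "H \<theta>1 \<theta>2 x $ 1 = \<theta>1 * x $ 1 / 2 * (x $ 1 + 2 * x $ 2)"
  "H \<theta>1 \<theta>2 x $ 2 = \<theta>2 * x $ 2 / 2 * (x $ 2 + 2 * x $ 1)"
  by (simp_all add: H_def)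

lemma Ebar_nth:
  "Ebar \<theta>1 \<theta>2 $ 1 = (4 * \<theta>1 - 2 * \<theta>2) / (3 * \<theta>1 * \<theta>2)"
  "Ebar \<theta>1 \<theta>2 $ 2 = (4 * \<theta>2 - 2 * \<theta>1) / (3 * \<theta>1 * \<theta>2)"
  by (simp_all add: Ebar_def)

lemma H_scaleR: "H \<theta>1 \<theta>2 (t *\<^sub>R x) = t\<^sup>2 *\<^sub>R H \<theta>1 \<theta>2 x"
  by (simp add: vec_eq_iff forall_2 power2_eq_square field_simps)

definition DH :: "real \<Rightarrow> real \<Rightarrow> real^2 \<Rightarrow> real^2^2" where
  "DH \<theta>1 \<theta>2 x = vector [vector [\<theta>1 * (x $ 1 + x $ 2), \<theta>1 * x $ 1],
                       vector [\<theta>2 * x $ 2, \<theta>2 * (x $ 1 + x $ 2)]]"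

lemma H_has_derivative: "(H \<theta>1 \<theta>2 has_derivative (*v) (DH \<theta>1 \<theta>2 x)) (at x)"
proof -
  have "((\<lambda>y. H \<theta>1 \<theta>2 y $ i) has_derivative (\<lambda>h. (DH \<theta>1 \<theta>2 x *v h) $ i)) (at x)" for i
  proof (cases "i = 1")
    case True
    then show ?thesis
      by (auto intro!: derivative_eq_intros bounded_linear.has_derivative[OF bounded_linear_vec_nth]
          simp: DH_def matrix_vector_mult_def sum_2 fun_eq_iff algebra_simps)
  next
    case False
    then have "i = 2"
      using exhaust_2 by blast
    then show ?thesis
      by (auto intro!: derivative_eq_intros bounded_linear.has_derivative[OF bounded_linear_vec_nth]
          simp: DH_def matrix_vector_mult_def sum_2 fun_eq_iff algebra_simps)
  qed
  then show ?thesis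
    by (subst has_derivative_componentwise_within) (auto simp: Basis_vec_def inner_axis)
qed

lemma jacobian_H: "jacobian (H \<theta>1 \<theta>2) (at x) = DH \<theta>1 \<theta>2 x"
  unfolding jacobian_def
  using frechet_derivative_at[OF H_has_derivative] by (metis matrix_of_matrix_vector_mul)

text \<open>Entrywise embedding into the complex numbers turns a real eigenvector into a complex
  one, so real eigenpairs suffice for the saddle.\<close>

lemma is_eigenvalue_real:
  assumes "A *v v = c *s v" "v \<noteq> 0"
  shows "is_eigenvalue A (complex_of_real c)"
proof -
  define w :: "complex^2" where "w = (\<chi> i. complex_of_real (v $ i))"
  have "w \<noteq> 0"
    using assms(2) by (simp add: w_def vec_eq_iff)
  moreover have "(\<chi> i j. complex_of_real (A $ i $ j)) *v w = complex_of_real c *s w"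
  proof -
    have "complex_of_real ((A *v v) $ i) = complex_of_real ((c *s v) $ i)" for i
      by (simp add: assms(1))
    then show ?thesis
      by (simp add: vec_eq_iff matrix_vector_mult_def w_def)
  qed
  ultimately show ?thesis
    unfolding is_eigenvalue_def by blast
qed

section \<open>The line as a ray through the fixed point\<close>

lemma Ebar_slope:
  assumes "\<theta>2 < 2 * \<theta>1"
  shows "Ebar \<theta>1 \<theta>2 $ 2 = (2 * \<theta>2 - \<theta>1) / (2 * \<theta>1 - \<theta>2) * Ebar \<theta>1 \<theta>2 $ 1"
proof -
  have eq: "4 * \<theta>1 - 2 * \<theta>2 = 2 * (2 * \<theta>1 - \<theta>2)" "4 * \<theta>2 - 2 * \<theta>1 = 2 * (2 * \<theta>2 - \<theta>1)"
    by simp_all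
  \<comment> \<open>For \<open>k = 0\<close> both sides are \<open>0\<close>, as division by zero
    yields \<open>0\<close>; hence \<open>d \<noteq> 0\<close> is the only side condition.\<close>
  have cancel: "2 * e / k = e / d * (2 * d / k)" if "d \<noteq> 0" for d e k :: real
    using that by simp
  show ?thesis
    unfolding Ebar_nth eq by (rule cancel) (use assms in simp)
qed

text \<open>Both coordinates of \<open>Ebar\<close> are positive, so the scale \<open>t\<close> can
  be read off from the first one. In this parameter \<open>H\<close> becomes squaring, with
  \<open>t = 0\<close> the origin and \<open>t = 1\<close> the fixed point.\<close>

lemma unstable_line_eq_ray:
  assumes "\<theta>1 > 0" "\<theta>2 > 0" "\<theta>1 < 2 * \<theta>2" "\<theta>2 < 2 * \<theta>1"
  shows "unstable_line \<theta>1 \<theta>2 = (\<lambda>t. t *\<^sub>R Ebar \<theta>1 \<theta>2) ` {0..}"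
proof (intro subset_antisym subsetI)
  fix x assume x: "x \<in> unstable_line \<theta>1 \<theta>2"
  define t where "t = x $ 1 / Ebar \<theta>1 \<theta>2 $ 1"
  have E1: "Ebar \<theta>1 \<theta>2 $ 1 > 0"
    using assms by (simp add: Ebar_nth)
  have "t \<ge> 0"
    using x E1 by (simp add: t_def unstable_line_def quadrant_def)
  moreover have "x = t *\<^sub>R Ebar \<theta>1 \<theta>2"
  proof -
    have x1: "x $ 1 = t * Ebar \<theta>1 \<theta>2 $ 1"
      using E1 by (simp add: t_def)
    moreover have "x $ 2 = t * Ebar \<theta>1 \<theta>2 $ 2"
      using x by (simp add: unstable_line_def x1 Ebar_slope[OF assms(4)])
    ultimately show ?thesis
      by (simp add: vec_eq_iff forall_2)
  qed
  ultimately show "x \<in> (\<lambda>t. t *\<^sub>R Ebar \<theta>1 \<theta>2) ` {0..}"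
    by auto
next
  fix x assume "x \<in> (\<lambda>t. t *\<^sub>R Ebar \<theta>1 \<theta>2) ` {0..}"
  then obtain t where t: "t \<ge> 0" "x = t *\<^sub>R Ebar \<theta>1 \<theta>2"
    by auto
  have "Ebar \<theta>1 \<theta>2 $ 1 \<ge> 0" "Ebar \<theta>1 \<theta>2 $ 2 \<ge> 0"
    using assms by (simp_all add: Ebar_nth)
  then have "x \<in> quadrant"
    using t by (simp add: quadrant_def)
  then show "x \<in> unstable_line \<theta>1 \<theta>2"
    using Ebar_slope[OF assms(4)] by (simp add: unstable_line_def t(2))
qed

section \<open>Fixed point equations and the transversal form\<close>

text \<open>The fixed point equations after cancelling nonzero coordinates. The polynomial
  identities below use them instead of the explicit quotients.\<close>

lemma Ebar_equations:
  assumes "\<theta>1 > 0" "\<theta>2 > 0"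
  shows "\<theta>1 * (Ebar \<theta>1 \<theta>2 $ 1 + 2 * Ebar \<theta>1 \<theta>2 $ 2) = 2"
    and "\<theta>2 * (Ebar \<theta>1 \<theta>2 $ 2 + 2 * Ebar \<theta>1 \<theta>2 $ 1) = 2"
  using assms by (simp_all add: Ebar_nth divide_simps)

lemma H_Ebar:
  assumes "\<theta>1 > 0" "\<theta>2 > 0"
  shows "H \<theta>1 \<theta>2 (Ebar \<theta>1 \<theta>2) = Ebar \<theta>1 \<theta>2"
  using Ebar_equations[OF assms] by (simp add: vec_eq_iff forall_2)

text \<open>The square terms on both sides agree, and the coefficients of the mixed term agree by
  the difference of the two fixed point equations.\<close>

lemma H_transversal:
  assumes "\<theta>1 > 0" "\<theta>2 > 0"
  defines "a \<equiv> Ebar \<theta>1 \<theta>2 $ 1" and "b \<equiv> Ebar \<theta>1 \<theta>2 $ 2"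
  shows "b * H \<theta>1 \<theta>2 x $ 1 - a * H \<theta>1 \<theta>2 x $ 2
    = (b * x $ 1 - a * x $ 2) * (\<theta>1 * x $ 1 + \<theta>2 * x $ 2) / 2"
proof -
  have "\<theta>1 * (a + 2 * b) = 2" "\<theta>2 * (b + 2 * a) = 2"
    using Ebar_equations[OF assms(1,2)] by (simp_all add: a_def b_def)
  then have "2 * \<theta>1 * b - 2 * \<theta>2 * a = \<theta>2 * b - \<theta>1 * a"
    by (simp add: algebra_simps)
  then have "(2 * \<theta>1 * b - 2 * \<theta>2 * a) * (x $ 1 * x $ 2) = (\<theta>2 * b - \<theta>1 * a) * (x $ 1 * x $ 2)"
    by simp
  then show ?thesis
    by (simp add: algebra_simps)
qed

text \<open>One step multiplies the form by \<open>?m / 2\<close> and the second coordinate by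
  \<open>?k / 2\<close>. The first factor alone is unbounded on the quadrant, but
  \<open>?m / ?k\<close> is at most \<open>1\<close> because
  \<open>\<theta>1 < 2 * \<theta>2\<close>.\<close>

lemma H_transversal_decreasing:
  assumes "\<theta>1 > 0" "\<theta>2 > 0" "\<theta>1 < 2 * \<theta>2" "x $ 1 > 0" "x $ 2 > 0"
  defines "a \<equiv> Ebar \<theta>1 \<theta>2 $ 1" and "b \<equiv> Ebar \<theta>1 \<theta>2 $ 2"
  shows "\<bar>(b * H \<theta>1 \<theta>2 x $ 1 - a * H \<theta>1 \<theta>2 x $ 2) / H \<theta>1 \<theta>2 x $ 2\<bar>
    \<le> \<bar>(b * x $ 1 - a * x $ 2) / x $ 2\<bar>"
proof -
  let ?d = "b * x $ 1 - a * x $ 2"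
  let ?m = "\<theta>1 * x $ 1 + \<theta>2 * x $ 2" and ?k = "\<theta>2 * (x $ 2 + 2 * x $ 1)"
  have m: "0 \<le> ?m" "0 < ?k" "?m \<le> ?k"
    using assms by (auto simp: algebra_simps add_pos_pos)
  have "(b * H \<theta>1 \<theta>2 x $ 1 - a * H \<theta>1 \<theta>2 x $ 2) / H \<theta>1 \<theta>2 x $ 2
      = (?d * ?m / 2) / (x $ 2 * ?k / 2)"
    using H_transversal[OF assms(1,2), of x] by (simp add: a_def b_def mult_ac)
  also have "\<dots> = (?d / x $ 2) * (?m / ?k)"
    by simp
  finally have "\<bar>(b * H \<theta>1 \<theta>2 x $ 1 - a * H \<theta>1 \<theta>2 x $ 2) / H \<theta>1 \<theta>2 x $ 2\<bar>
      = \<bar>?d / x $ 2\<bar> * (?m / ?k)"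
    using m(1,2) by (simp only: abs_mult[of _ "?m / ?k"] abs_of_nonneg divide_nonneg_pos)
  also have "\<dots> \<le> \<bar>?d / x $ 2\<bar> * 1"
    using m by (intro mult_left_mono) auto
  finally show ?thesis
    by simp
qed

lemma H_image_quadrant:
  assumes "\<theta>1 > 0" "\<theta>2 > 0"
  shows "H \<theta>1 \<theta>2 ` quadrant \<subseteq> quadrant"
  using assms by (auto simp: quadrant_def)

section \<open>Eigenvalues at the fixed point\<close>

lemma saddle_Ebar:
  assumes "\<theta>1 > 0" "\<theta>2 > 0" "\<theta>1 < 2 * \<theta>2" "\<theta>2 < 2 * \<theta>1"
  shows "saddle (H \<theta>1 \<theta>2) (Ebar \<theta>1 \<theta>2)"
proof -
  define a b where ab: "a = Ebar \<theta>1 \<theta>2 $ 1" "b = Ebar \<theta>1 \<theta>2 $ 2"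
  let ?J = "DH \<theta>1 \<theta>2 (Ebar \<theta>1 \<theta>2)"
  have eq: "\<theta>1 * (a + 2 * b) = 2" "\<theta>2 * (b + 2 * a) = 2"
    using Ebar_equations[OF assms(1,2)] by (simp_all add: ab)
  have pos: "a > 0" "b > 0"
    using assms by (simp_all add: ab Ebar_nth)
  \<comment> \<open>Euler's identity in degree two: the derivative at \<open>Ebar\<close> sends
    \<open>Ebar\<close> to twice its image under \<open>H\<close>, and \<open>Ebar\<close> is
    fixed.\<close>
  have "?J *v Ebar \<theta>1 \<theta>2 = 2 *s Ebar \<theta>1 \<theta>2"
  proof -
    have "\<theta>1 * (a + b) * a + \<theta>1 * a * b = 2 * a" "\<theta>2 * b * a + \<theta>2 * (a + b) * b = 2 * b"
      using arg_cong[OF eq(1), of "\<lambda>z. a * z"] arg_cong[OF eq(2), of "\<lambda>z. b * z"]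
      by (simp_all add: algebra_simps)
    then show ?thesis
      by (simp add: vec_eq_iff forall_2 DH_def matrix_vector_mult_def sum_2 ab)
  qed
  moreover have "Ebar \<theta>1 \<theta>2 \<noteq> 0"
    using pos by (auto simp: ab)
  ultimately have 2: "is_eigenvalue ?J (complex_of_real 2)"
    by (rule is_eigenvalue_real)
  \<comment> \<open>This is the factor of \<open>H_transversal\<close> evaluated at
    \<open>Ebar\<close>, hence the candidate for the eigenvalue transversal to the ray.\<close>
  define c where "c = (\<theta>1 * a + \<theta>2 * b) / 2"
  have "?J *v vector [\<theta>1, - \<theta>2] = c *s vector [\<theta>1, - \<theta>2]"
  proof -
    have "2 * c = \<theta>1 * a + \<theta>2 * b"
      by (simp add: c_def)
    then have *: "\<theta>1 * (a + b) - \<theta>2 * a = c" "\<theta>2 * (a + b) - \<theta>1 * b = c"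
      using eq by (simp_all add: algebra_simps)
    have "\<theta>1 * (a + b) * \<theta>1 + \<theta>1 * a * (- \<theta>2) = c * \<theta>1"
      "\<theta>2 * b * \<theta>1 + \<theta>2 * (a + b) * (- \<theta>2) = c * (- \<theta>2)"
      by (simp add: *(1)[symmetric] algebra_simps, simp add: *(2)[symmetric] algebra_simps)
    then show ?thesis
      by (simp add: vec_eq_iff forall_2 DH_def matrix_vector_mult_def sum_2 ab)
  qed
  moreover have "vector [\<theta>1, - \<theta>2] \<noteq> (0 :: real^2)"
    using assms by (simp add: vec_eq_iff forall_2)
  ultimately have c: "is_eigenvalue ?J (complex_of_real c)"
    by (rule is_eigenvalue_real)
  \<comment> \<open>Adding \<open>\<theta>2 * b\<close> to both sides makes the right one equal to
    \<open>2\<close> and the left one equal to \<open>2 * c\<close>.\<close>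
  have "\<theta>1 * a < 2 * \<theta>2 * a"
    using assms pos by simp
  then have "c < 1"
    using eq by (simp add: c_def algebra_simps)
  moreover have "c > 0"
    using assms pos by (simp add: c_def add_pos_pos)
  ultimately have "cmod (complex_of_real c) < 1"
    by simp
  moreover have "1 < cmod (complex_of_real 2)"
    by simp
  moreover have "H \<theta>1 \<theta>2 differentiable at (Ebar \<theta>1 \<theta>2)"
    using H_has_derivative by (auto simp: differentiable_def)
  ultimately show ?thesis
    using 2 c H_Ebar[OF assms(1,2)] unfolding saddle_def jacobian_H by blast
qed

section \<open>Backward orbits and the unstable set\<close>

text \<open>Convergence to an interior point makes the coordinates eventually positive, and
  \<open>H\<close> preserves positivity, so it descends from large indices to all smaller
  ones.\<close>

lemma backward_orbit_pos:
  assumes "\<theta>1 > 0" "\<theta>2 > 0" "p $ 1 > 0" "p $ 2 > 0"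
    and orbit: "\<And>n. H \<theta>1 \<theta>2 (y (Suc n)) = y n" and lim: "y \<longlonglongrightarrow> p"
  shows "y n $ 1 > 0 \<and> y n $ 2 > 0"
proof -
  have "\<forall>\<^sub>F m in sequentially. y m $ i > 0" if "p $ i > 0" for i
    using order_tendstoD(1)[OF tendsto_vec_nth[OF lim] that] .
  then have "\<forall>\<^sub>F m in sequentially. y m $ 1 > 0 \<and> y m $ 2 > 0"
    using assms(3,4) by (intro eventually_conj)
  then obtain N where N: "\<And>m. m \<ge> N \<Longrightarrow> y m $ 1 > 0 \<and> y m $ 2 > 0"
    by (auto simp: eventually_sequentially)
  have pos_step: "y k $ 1 > 0 \<and> y k $ 2 > 0" if "y (Suc k) $ 1 > 0 \<and> y (Suc k) $ 2 > 0" for k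
    using that assms(1,2) orbit[of k, symmetric] by (simp add: add_pos_pos)
  \<comment> \<open>Starting the descent at \<open>max n N\<close> also covers the indices beyond
    \<open>N\<close>.\<close>
  have "n \<le> max n N"
    by simp
  then show ?thesis
  proof (induction rule: inc_induct)
    case base
    show ?case
      by (rule N) simp
  next
    case (step m)
    show ?case
      by (rule pos_step) (fact step.IH)
  qed
qed

lemma unstable_set_subset:
  assumes "\<theta>1 > 0" "\<theta>2 > 0" "\<theta>1 < 2 * \<theta>2" "\<theta>2 < 2 * \<theta>1"
  shows "unstable_set quadrant (H \<theta>1 \<theta>2) (Ebar \<theta>1 \<theta>2) \<subseteq> unstable_line \<theta>1 \<theta>2 - {0}"
proof
  fix x assume "x \<in> unstable_set quadrant (H \<theta>1 \<theta>2) (Ebar \<theta>1 \<theta>2)"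
  then obtain y where y: "y 0 = x" "\<And>n. H \<theta>1 \<theta>2 (y (Suc n)) = y n" "y \<longlonglongrightarrow> Ebar \<theta>1 \<theta>2"
    by (auto simp: unstable_set_def)
  define a b where ab: "a = Ebar \<theta>1 \<theta>2 $ 1" "b = Ebar \<theta>1 \<theta>2 $ 2"
  define r where "r n = \<bar>(b * y n $ 1 - a * y n $ 2) / y n $ 2\<bar>" for n
  have pos: "a > 0" "b > 0"
    using assms by (simp_all add: ab Ebar_nth)
  have ypos: "y n $ 1 > 0" "y n $ 2 > 0" for n
    using backward_orbit_pos[OF assms(1,2) _ _ y(2,3)] pos by (auto simp: ab)
  \<comment> \<open>Increasing \<open>n\<close> runs backward in time, so a quantity that does not
    grow under \<open>H\<close> does not shrink with \<open>n\<close>.\<close>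
  have "r n \<le> r (Suc n)" for n
    using H_transversal_decreasing[OF assms(1-3) ypos, of "Suc n"]
    unfolding y(2) r_def ab .
  then have "r 0 \<le> r n" for n
    using incseq_SucI[of r] by (simp add: incseqD)
  moreover have "r \<longlonglongrightarrow> \<bar>(b * a - a * b) / b\<bar>"
    unfolding r_def using pos tendsto_vec_nth[OF y(3)]
    by (intro tendsto_intros) (auto simp: ab)
  \<comment> \<open>The limit simplifies to \<open>0\<close>, and \<open>r 0\<close> is a lower
    bound of the whole sequence.\<close>
  ultimately have "r 0 \<le> 0"
    by (intro LIMSEQ_le_const[of r]) (auto simp: mult.commute)
  then have "b * x $ 1 = a * x $ 2"
    using ypos[of 0] by (simp add: r_def y(1))
  then have "x = (x $ 1 / a) *\<^sub>R Ebar \<theta>1 \<theta>2"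
    using pos by (simp add: vec_eq_iff forall_2 ab[symmetric] field_simps)
  moreover have "x $ 1 / a \<ge> 0"
    using pos ypos[of 0] y(1) by simp
  ultimately have "x \<in> unstable_line \<theta>1 \<theta>2"
    unfolding unstable_line_eq_ray[OF assms] by blast
  moreover have "x \<noteq> 0"
    using ypos[of 0] y(1) by auto
  ultimately show "x \<in> unstable_line \<theta>1 \<theta>2 - {0}"
    by simp
qed

lemma unstable_set_superset:
  assumes "\<theta>1 > 0" "\<theta>2 > 0" "\<theta>1 < 2 * \<theta>2" "\<theta>2 < 2 * \<theta>1"
  shows "unstable_line \<theta>1 \<theta>2 - {0} \<subseteq> unstable_set quadrant (H \<theta>1 \<theta>2) (Ebar \<theta>1 \<theta>2)"
proof
  fix x assume "x \<in> unstable_line \<theta>1 \<theta>2 - {0}"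
  then obtain t where t: "t > 0" "x = t *\<^sub>R Ebar \<theta>1 \<theta>2"
    unfolding unstable_line_eq_ray[OF assms] by (auto simp: less_le)
  \<comment> \<open>Halving the exponent takes a square root, so the squaring in
    \<open>H_scaleR\<close> leads from index \<open>Suc n\<close> back to \<open>n\<close>.\<close>
  define y where "y n = (t powr ((1/2)^n)) *\<^sub>R Ebar \<theta>1 \<theta>2" for n
  have "y 0 = x"
    using t by (simp add: y_def)
  moreover have "y n \<in> quadrant" for n
    using assms by (simp add: y_def quadrant_def Ebar_nth)
  moreover have "H \<theta>1 \<theta>2 (y (Suc n)) = y n" for n
    by (simp add: y_def H_scaleR H_Ebar assms power2_eq_square flip: powr_add)
  \<comment> \<open>The exponents tend to \<open>0\<close>, and \<open>t powr 0\<close> is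
    \<open>1\<close> because \<open>t > 0\<close>; by convention \<open>0 powr 0\<close> would be
    \<open>0\<close>.\<close>
  moreover have "y \<longlonglongrightarrow> (t powr 0) *\<^sub>R Ebar \<theta>1 \<theta>2"
    unfolding y_def using t by (intro tendsto_intros LIMSEQ_power_zero) auto
  ultimately show "x \<in> unstable_set quadrant (H \<theta>1 \<theta>2) (Ebar \<theta>1 \<theta>2)"
    using t unfolding unstable_set_def by auto
qed

section \<open>Topology and dynamics of the line\<close>

text \<open>The line is closed, and the one removed point is recovered as a limit of small positive
  multiples of \<open>Ebar\<close>.\<close>

lemma closure_punctured_line:
  assumes "\<theta>1 > 0" "\<theta>2 > 0" "\<theta>1 < 2 * \<theta>2" "\<theta>2 < 2 * \<theta>1"
  shows "closure (unstable_line \<theta>1 \<theta>2 - {0}) = unstable_line \<theta>1 \<theta>2"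
proof (intro subset_antisym)
  have "closed (unstable_line \<theta>1 \<theta>2)"
    unfolding unstable_line_def quadrant_def mem_Collect_eq
    by (intro closed_Collect_conj closed_Collect_le closed_Collect_eq continuous_intros)
  then show "closure (unstable_line \<theta>1 \<theta>2 - {0}) \<subseteq> unstable_line \<theta>1 \<theta>2"
    by (intro closure_minimal) auto
  have E: "Ebar \<theta>1 \<theta>2 \<noteq> 0"
    using assms by (auto simp: vec_eq_iff forall_2 Ebar_nth)
  have "inverse (real (Suc n)) *\<^sub>R Ebar \<theta>1 \<theta>2 \<in> unstable_line \<theta>1 \<theta>2 - {0}" for n
    using E unfolding unstable_line_eq_ray[OF assms] by auto
  moreover have "(\<lambda>n. inverse (real (Suc n)) *\<^sub>R Ebar \<theta>1 \<theta>2) \<longlonglongrightarrow> 0 *\<^sub>R Ebar \<theta>1 \<theta>2"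
    by (intro tendsto_intros LIMSEQ_inverse_real_of_nat)
  ultimately have "0 \<in> closure (unstable_line \<theta>1 \<theta>2 - {0})"
    unfolding closure_sequential scaleR_zero_left
    by (intro exI[of _ "\<lambda>n. inverse (real (Suc n)) *\<^sub>R Ebar \<theta>1 \<theta>2"]) simp
  then show "unstable_line \<theta>1 \<theta>2 \<subseteq> closure (unstable_line \<theta>1 \<theta>2 - {0})"
    using closure_subset[of "unstable_line \<theta>1 \<theta>2 - {0}"] by auto
qed

text \<open>In the ray parameter this says that squaring maps the nonnegative reals onto
  themselves.\<close>

lemma H_image_line:
  assumes "\<theta>1 > 0" "\<theta>2 > 0" "\<theta>1 < 2 * \<theta>2" "\<theta>2 < 2 * \<theta>1"
  shows "H \<theta>1 \<theta>2 ` unstable_line \<theta>1 \<theta>2 = unstable_line \<theta>1 \<theta>2"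
proof -
  have "(\<lambda>t. t\<^sup>2) ` {0::real..} = {0..}"
  proof (intro subset_antisym subsetI)
    fix t :: real assume "t \<in> {0..}"
    then show "t \<in> (\<lambda>t. t\<^sup>2) ` {0..}"
      by (intro image_eqI[of _ _ "sqrt t"]) auto
  qed auto
  moreover have "H \<theta>1 \<theta>2 ` unstable_line \<theta>1 \<theta>2 = (\<lambda>t. t *\<^sub>R Ebar \<theta>1 \<theta>2) ` (\<lambda>t. t\<^sup>2) ` {0..}"
    unfolding unstable_line_eq_ray[OF assms] image_image
    by (simp add: H_scaleR H_Ebar assms(1,2))
  ultimately show ?thesis
    by (simp add: unstable_line_eq_ray[OF assms])
qed

text \<open>This makes moving away from \<open>Ebar\<close> precise. Iterates have parameter
  \<open>t ^ (2 ^ n)\<close>, and the two excluded points are those with \<open>t = 0\<close> and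
  \<open>t = 1\<close>, the parameters fixed by squaring.\<close>

lemma strict_mono_dist_line:
  assumes "\<theta>1 > 0" "\<theta>2 > 0" "\<theta>1 < 2 * \<theta>2" "\<theta>2 < 2 * \<theta>1"
    and x: "x \<in> unstable_line \<theta>1 \<theta>2 - {0, Ebar \<theta>1 \<theta>2}"
  shows "strict_mono (\<lambda>n. dist ((H \<theta>1 \<theta>2 ^^ n) x) (Ebar \<theta>1 \<theta>2))"
proof -
  obtain t where "t \<ge> 0" and xt: "x = t *\<^sub>R Ebar \<theta>1 \<theta>2"
    using x unfolding unstable_line_eq_ray[OF assms(1-4)] by auto
  moreover have "t \<noteq> 0" "t \<noteq> 1"
    using x xt by auto
  ultimately have t: "t > 0" "t \<noteq> 1"
    by simp_all
  have E: "norm (Ebar \<theta>1 \<theta>2) > 0"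
    using assms(1-4) by (auto simp: vec_eq_iff forall_2 Ebar_nth)
  have "(H \<theta>1 \<theta>2 ^^ n) x = t ^ (2 ^ n) *\<^sub>R Ebar \<theta>1 \<theta>2" for n
    by (induction n) (simp_all add: xt H_scaleR H_Ebar assms(1,2) power_mult[symmetric] mult.commute)
  then have "dist ((H \<theta>1 \<theta>2 ^^ n) x) (Ebar \<theta>1 \<theta>2) = \<bar>t ^ (2 ^ n) - 1\<bar> * norm (Ebar \<theta>1 \<theta>2)" for n
    unfolding dist_norm by (metis norm_scaleR scaleR_left_diff_distrib scaleR_one)
  moreover have "\<bar>t ^ (2 ^ n) - 1\<bar> < \<bar>t ^ (2 ^ Suc n) - 1\<bar>" for n
  proof -
    \<comment> \<open>One squaring multiplies the distance of the parameter from \<open>1\<close> by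
      \<open>s + 1\<close>, which exceeds \<open>1\<close>.\<close>
    define s where "s = t ^ (2 ^ n)"
    have s: "s > 0" "s \<noteq> 1"
      using t power_eq_iff_eq_base[of "2 ^ n" t 1] by (auto simp: s_def)
    have "t ^ (2 ^ Suc n) = s\<^sup>2"
      unfolding s_def power_mult[symmetric] by (simp add: mult.commute)
    then have "t ^ (2 ^ Suc n) - 1 = (s - 1) * (s + 1)"
      by (simp add: algebra_simps power2_eq_square)
    then have "\<bar>t ^ (2 ^ Suc n) - 1\<bar> = \<bar>s - 1\<bar> * (s + 1)"
      using s by (simp add: abs_mult)
    moreover have "\<bar>s - 1\<bar> * 1 < \<bar>s - 1\<bar> * (s + 1)"
      using s by (intro mult_strict_left_mono) auto
    ultimately show ?thesis
      by (simp add: s_def)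
  qed
  ultimately show ?thesis
    using E by (simp add: strict_mono_Suc_iff)
qed

text \<open>An unstable curve combines backward convergence, invariance and forward departure, so
  each is stated. The closure appears because within the quadrant the origin is its own only
  preimage and so cannot lie in the unstable set.\<close>

theorem proposition12:
  fixes \<theta>1 \<theta>2 :: real
  assumes "\<theta>1 > 0" and "\<theta>2 > 0" and "\<theta>1 < 2 * \<theta>2" and "\<theta>2 < 2 * \<theta>1"
  shows "H \<theta>1 \<theta>2 ` quadrant \<subseteq> quadrant
    \<and> Ebar \<theta>1 \<theta>2 \<in> quadrant
    \<and> saddle (H \<theta>1 \<theta>2) (Ebar \<theta>1 \<theta>2)
    \<and> unstable_set quadrant (H \<theta>1 \<theta>2) (Ebar \<theta>1 \<theta>2) = unstable_line \<theta>1 \<theta>2 - {0}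
    \<and> closure (unstable_set quadrant (H \<theta>1 \<theta>2) (Ebar \<theta>1 \<theta>2)) = unstable_line \<theta>1 \<theta>2
    \<and> 0 \<in> unstable_line \<theta>1 \<theta>2
    \<and> Ebar \<theta>1 \<theta>2 \<in> unstable_line \<theta>1 \<theta>2
    \<and> H \<theta>1 \<theta>2 ` unstable_line \<theta>1 \<theta>2 = unstable_line \<theta>1 \<theta>2
    \<and> (\<forall>x \<in> unstable_line \<theta>1 \<theta>2 - {0, Ebar \<theta>1 \<theta>2}.
         strict_mono (\<lambda>n. dist ((H \<theta>1 \<theta>2 ^^ n) x) (Ebar \<theta>1 \<theta>2)))"
proof -
  have set_eq: "unstable_set quadrant (H \<theta>1 \<theta>2) (Ebar \<theta>1 \<theta>2) = unstable_line \<theta>1 \<theta>2 - {0}"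
    using unstable_set_subset[OF assms] unstable_set_superset[OF assms] by blast
  have ray: "t *\<^sub>R Ebar \<theta>1 \<theta>2 \<in> unstable_line \<theta>1 \<theta>2" if "t \<ge> 0" for t
    using that unfolding unstable_line_eq_ray[OF assms] by blast
  have "0 \<in> unstable_line \<theta>1 \<theta>2" "Ebar \<theta>1 \<theta>2 \<in> unstable_line \<theta>1 \<theta>2"
    using ray[of 0] ray[of 1] by simp_all
  moreover from this have "Ebar \<theta>1 \<theta>2 \<in> quadrant"
    by (simp add: unstable_line_def)
  ultimately show ?thesis
    using H_image_quadrant[OF assms(1,2)] saddle_Ebar[OF assms] set_eq
      closure_punctured_line[OF assms] H_image_line[OF assms] strict_mono_dist_line[OF assms]
    by simp
qed

end
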